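(* Let $S$ be a set and let $\mathbf\Sigma=(\Sigma,E)$ be an $S$-sorted second-order presentation. Suppose that $(\mathbf Y,\llbracket-\rrbracket)$ is a $\mathbf\Sigma$-algebra, that $f:\mathbf X\to\mathbf Y$ is a clone homomorphism from an $S$-sorted clone $\mathbf X$, and that $P$ is a predicate over $\mathbf Y$. If (i) for all operators $\mathsf o\in\Sigma((\Delta_1;A_1),\dots,(\Delta_n;A_n);B)$, contexts $\Gamma\in S^*$, and tuples of terms $(t_i\in P(\Gamma,\Delta_i;A_i))_{i}$ we have $\llbracket\mathsf o\rrbracket_\Gamma(t_1,\dots,t_n)\in P(\Gamma;B)$; and (ii) for all terms $t\in X(\Gamma;A)$ (for all $\Gamma\in S^*$, $A\in S$) we have $f_{\Gamma;A}(t)\in P(\Gamma;A)$, then for all $\Gamma\in S^*$, $A\in S$ and all $t\in(F_{\mathbf\Sigma}\mathbf X)(\Gamma;A)$ we have $f^\dagger_{\Gamma;A}(t)\in P(\Gamma;A)$, where $F_{\mathbf\Sigma}\mathbf X$ is the free $\mathbf\Sigma$-algebra on $\mathbf X$ and $f^\dagger:F_{\mathbf\Sigma}\mathbf X\to(\mathbf Y,\llbracket-\rrbracket)$ is the unique algebra homomorphism extending $f$.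
   Context: Fix a set $S$ of sorts. $S^*$ is the set of finite lists over $S$ (contexts); $\diamond$ is the empty list; $\Gamma,\Xi$ denotes concatenation. Given sets $X(\Gamma;A)$ for $\Gamma\in S^*$, $A\in S$, write $X(\Gamma;\Delta)=\prod_{i\le n}X(\Gamma;A_i)$ for $\Delta=[A_1,\dots,A_n]$; its elements are called substitutions. An $S$-sorted clone $\mathbf X=(X,\mathsf{var},\mathsf{subst})$ consists of: sets $X(\Gamma;A)$ for all $\Gamma\in S^*,A\in S$; a tuple $\mathsf{var}^{(\Gamma)}\in X(\Gamma;\Gamma)$ for each $\Gamma$; functions $X(\Delta;A)\times X(\Gamma;\Delta)\to X(\Gamma;A)$, written $(t,\boldsymbol\sigma)\mapsto t[\boldsymbol\sigma]$; such that $\mathsf{var}^{(\Delta)}_i[\boldsymbol\sigma]=\sigma_i$, $t[\mathsf{var}^{(\Gamma)}]=t$, and $t[\sigma'_1[\boldsymbol\sigma],\dots,\sigma'_m[\boldsymbol\sigma]]=(t[\boldsymbol\sigma'])[\boldsymbol\sigma]$ for $t\in X(\Xi;A)$, $\boldsymbol\sigma'\in X(\Delta;\Xi)$, $\boldsymbol\sigma\in X(\Gamma;\Delta)$. A clone homomorphism $\mathbf X\to\mathbf X'$ is a family of functions $f_{\Gamma;B}:X(\Gamma;B)\to X'(\Gamma;B)$ preserving variables and substitution: $f(\mathsf{var}^{(\Delta)}_i)=\mathsf{var}'^{(\Delta)}_i$ and $f(t[\boldsymbol\sigma])=f(t)[f(\sigma_1),\dots,f(\sigma_n)]'$. Lifting: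 for $\boldsymbol\sigma\in X(\Gamma;\Delta)$ and $\Xi\in S^*$, with $n,m$ the lengths of $\Gamma,\Xi$, let $\mathsf{lift}_\Xi(\boldsymbol\sigma)\in X(\Gamma,\Xi;\Delta,\Xi)$ be the substitution consisting of the terms $\sigma_j[\mathsf{var}^{(\Gamma,\Xi)}_1,\dots,\mathsf{var}^{(\Gamma,\Xi)}_n]$ for each $j$, followed by $\mathsf{var}^{(\Gamma,\Xi)}_{n+1},\dots,\mathsf{var}^{(\Gamma,\Xi)}_{n+m}$. An $S$-sorted second-order signature $\Sigma$ is a set $\Sigma(\Psi;B)$ of operators for each $(\Psi;B)\in(S^*\times S)^*\times S$. Terms over $\Sigma$, in a metavariable context $\Psi$ (list of metavariables $M_i:(\Delta_i;A_i)$ with $\Delta_i\in S^*$, $A_i\in S$) and a variable context $\Gamma$, with judgment $\Psi\mid\Gamma\vdash t:A$, are generated by: variables ($\Psi\mid\Gamma,x:A,\Delta\vdash x:A$); metavariable application (if $M:(A_1,\dots,A_n;B)$ is in $\Psi$ and $\Psi\mid\Gamma\vdash t_i:A_i$ for all $i$, then $\Psi\mid\Gamma\vdash M(t_1,\dots,t_n):B$); operators (if $\mathsf o\in\Sigma((\Delta_1;A_1),\dots,(\Delta_n;A_n);B)$ and $\Psi\mid\Gamma,\vec x_i:\Delta_i\vdash t_i:A_i$ for all $i$, then $\Psi\mid\Gamma\vdash\mathsf o((\vec x_1.t_1),\dots,(\vec x_n.t_n)):B$, where $\vec x_i$ is bound in $t_i$). Terms are identified up to $\alpha$-equivalence. A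 $(\Psi;B)$-ary term is a term $\Psi\mid\diamond\vdash t:B$; a $(\Psi;B)$-ary equation is a pair of $(\Psi;B)$-ary terms. An $S$-sorted second-order presentation $\mathbf\Sigma=(\Sigma,E)$ is a signature $\Sigma$ with a set $E(\Psi;B)$ of $(\Psi;B)$-ary equations for each $(\Psi;B)$. A $\Sigma$-algebra $(\mathbf X,\llbracket-\rrbracket)$ is an $S$-sorted clone $\mathbf X$ with, for each $\Gamma$ and each $\mathsf o\in\Sigma((\Delta_1;A_1),\dots,(\Delta_n;A_n);B)$, a function $\llbracket\mathsf o\rrbracket_\Gamma:\prod_iX(\Gamma,\Delta_i;A_i)\to X(\Gamma;B)$ such that $(\llbracket\mathsf o\rrbracket_\Gamma(t_1,\dots,t_n))[\boldsymbol\sigma]=\llbracket\mathsf o\rrbracket_\Xi(t_1[\mathsf{lift}_{\Delta_1}\boldsymbol\sigma],\dots,t_n[\mathsf{lift}_{\Delta_n}\boldsymbol\sigma])$ for all $\boldsymbol\sigma\in X(\Xi;\Gamma)$. A $\Sigma$-algebra homomorphism is a clone homomorphism $f$ with $f(\llbracket\mathsf o\rrbracket_\Gamma(t_1,\dots,t_n))=\llbracket\mathsf o\rrbracket'_\Gamma(f(t_1),\dots,f(t_n))$ for all operators. In a $\Sigma$-algebra each term $M_1:(\Delta_1;A_1),\dots,M_k:(\Delta_k;A_k)\mid\vec x:\Xi\vdash t:B$ has an interpretation $\llbracket t\rrbracket_\Gamma:\prod_iX(\Gamma,\Delta_i;A_i)\to X(\Gamma,\Xi;B)$ for each $\Gamma$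 (of length $n$): $\llbracket x_i\rrbracket_\Gamma(\boldsymbol\sigma)=\mathsf{var}^{(\Gamma,\Xi)}_{n+i}$; $\llbracket M_i(t_1,\dots,t_m)\rrbracket_\Gamma(\boldsymbol\sigma)=\sigma_i[\mathsf{var}^{(\Gamma,\Xi)}_1,\dots,\mathsf{var}^{(\Gamma,\Xi)}_n,\llbracket t_1\rrbracket_\Gamma(\boldsymbol\sigma),\dots,\llbracket t_m\rrbracket_\Gamma(\boldsymbol\sigma)]$; $\llbracket\mathsf o((\vec x_1.t_1),\dots,(\vec x_m.t_m))\rrbracket_\Gamma(\boldsymbol\sigma)=\llbracket\mathsf o\rrbracket_{\Gamma,\Xi}(\llbracket t_1\rrbracket_\Gamma(\boldsymbol\sigma),\dots,\llbracket t_m\rrbracket_\Gamma(\boldsymbol\sigma))$. A $\mathbf\Sigma$-algebra, for $\mathbf\Sigma=(\Sigma,E)$, is a $\Sigma$-algebra such that $\llbracket t\rrbracket_\Gamma=\llbracket u\rrbracket_\Gamma$ for all $(t,u)\in E(\Psi;A)$ and all $\Gamma$. The free $\mathbf\Sigma$-algebra on a clone $\mathbf X$ is a $\mathbf\Sigma$-algebra $F_{\mathbf\Sigma}\mathbf X$ with a clone homomorphism $\eta_{\mathbf X}:\mathbf X\to F_{\mathbf\Sigma}\mathbf X$ such that for every $\mathbf\Sigma$-algebra $(\mathbf Y,\llbracket-\rrbracket)$ and clone homomorphism $f:\mathbf X\to\mathbf Y$ there is a unique $\Sigma$-algebra homomorphism $f^\dagger:F_{\mathbf\Sigma}\mathbf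 X\to(\mathbf Y,\llbracket-\rrbracket)$ with $f^\dagger\circ\eta_{\mathbf X}=f$. (It always exists.) A predicate $P$ over an $S$-sorted clone $\mathbf Y$ is a family of subsets $P(\Gamma;A)\subseteq Y(\Gamma;A)$ such that $\mathsf{var}^{(\Gamma)}_i\in P(\Gamma;A_i)$ for all $\Gamma=[A_1,\dots,A_n]$ and $i\le n$, and $t[\boldsymbol\sigma]\in P(\Gamma;B)$ whenever $t\in P(\Delta;B)$ and $\boldsymbol\sigma\in P(\Gamma;\Delta)$, where $P(\Gamma;A_1,\dots,A_n)$ is the set of $\boldsymbol\sigma\in Y(\Gamma;A_1,\dots,A_n)$ with $\sigma_i\in P(\Gamma;A_i)$ for all $i$. *)

theory Defs
  imports Main
begin

section \<open>Sorted clones\<close>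

text \<open>
  The sorts are the elements of the type \<open>'s\<close>. The families of sets \<open>X(\<Gamma>;A)\<close> are families of
  subsets of one type that need not be disjoint, so substitution carries the contexts and
  the sort at which it is used: \<open>subst X \<Gamma> \<Delta> A\<close> is the map
  \<open>X(\<Delta>;A) \<times> X(\<Gamma>;\<Delta>) \<rightarrow> X(\<Gamma>;A)\<close>. Values outside the given sets are irrelevant.
  Tuples are lists; positions are counted from \<open>0\<close>.
\<close>

record ('s, 'x) clone =
  tms :: "'s list \<Rightarrow> 's \<Rightarrow> 'x set"
  var :: "'s list \<Rightarrow> 'x list"
  subst :: "'s list \<Rightarrow> 's list \<Rightarrow> 's \<Rightarrow> 'x \<Rightarrow> 'x list \<Rightarrow> 'x"

text \<open>\<open>X(\<Gamma>;\<Delta>)\<close> for a family of sets \<open>X\<close>.\<close>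

definition substs :: "('s list \<Rightarrow> 's \<Rightarrow> 'x set) \<Rightarrow> 's list \<Rightarrow> 's list \<Rightarrow> 'x list set" where
  "substs X \<Gamma> \<Delta> = {\<sigma>. list_all2 (\<lambda>t A. t \<in> X \<Gamma> A) \<sigma> \<Delta>}"

locale clone =
  fixes X :: "('s, 'x, 'm) clone_scheme"
  assumes var_closed: "var X \<Gamma> \<in> substs (tms X) \<Gamma> \<Gamma>"
    and subst_closed:
      "\<lbrakk>t \<in> tms X \<Delta> A; \<sigma> \<in> substs (tms X) \<Gamma> \<Delta>\<rbrakk> \<Longrightarrow> subst X \<Gamma> \<Delta> A t \<sigma> \<in> tms X \<Gamma> A"
    and var_subst:
      "\<lbrakk>\<sigma> \<in> substs (tms X) \<Gamma> \<Delta>; i < length \<Delta>\<rbrakk>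
        \<Longrightarrow> subst X \<Gamma> \<Delta> (\<Delta> ! i) (var X \<Delta> ! i) \<sigma> = \<sigma> ! i"
    and subst_var: "t \<in> tms X \<Gamma> A \<Longrightarrow> subst X \<Gamma> \<Gamma> A t (var X \<Gamma>) = t"
    and subst_subst:
      "\<lbrakk>t \<in> tms X \<Xi> A; \<sigma>' \<in> substs (tms X) \<Delta> \<Xi>; \<sigma> \<in> substs (tms X) \<Gamma> \<Delta>\<rbrakk>
        \<Longrightarrow> subst X \<Gamma> \<Xi> A t (map2 (\<lambda>s B. subst X \<Gamma> \<Delta> B s \<sigma>) \<sigma>' \<Xi>)
          = subst X \<Gamma> \<Delta> A (subst X \<Delta> \<Xi> A t \<sigma>') \<sigma>"

locale clone_hom =
  fixes X :: "('s, 'x, 'm) clone_scheme"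
    and Y :: "('s, 'y, 'n) clone_scheme"
    and f :: "'s list \<Rightarrow> 's \<Rightarrow> 'x \<Rightarrow> 'y"
  assumes hom_closed: "t \<in> tms X \<Gamma> A \<Longrightarrow> f \<Gamma> A t \<in> tms Y \<Gamma> A"
    and hom_var: "i < length \<Delta> \<Longrightarrow> f \<Delta> (\<Delta> ! i) (var X \<Delta> ! i) = var Y \<Delta> ! i"
    and hom_subst:
      "\<lbrakk>t \<in> tms X \<Delta> A; \<sigma> \<in> substs (tms X) \<Gamma> \<Delta>\<rbrakk>
        \<Longrightarrow> f \<Gamma> A (subst X \<Gamma> \<Delta> A t \<sigma>)
          = subst Y \<Gamma> \<Delta> A (f \<Delta> A t) (map2 (\<lambda>s B. f \<Gamma> B s) \<sigma> \<Delta>)"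

text \<open>\<open>lift X \<Gamma> \<Delta> \<Xi> \<sigma> \<in> X(\<Gamma>,\<Xi>;\<Delta>,\<Xi>)\<close> for \<open>\<sigma> \<in> X(\<Gamma>;\<Delta>)\<close>.\<close>

definition lift ::
  "('s, 'x, 'm) clone_scheme \<Rightarrow> 's list \<Rightarrow> 's list \<Rightarrow> 's list \<Rightarrow> 'x list \<Rightarrow> 'x list" where
  "lift X \<Gamma> \<Delta> \<Xi> \<sigma> =
    map2 (\<lambda>t A. subst X (\<Gamma> @ \<Xi>) \<Gamma> A t (take (length \<Gamma>) (var X (\<Gamma> @ \<Xi>)))) \<sigma> \<Delta>
    @ drop (length \<Gamma>) (var X (\<Gamma> @ \<Xi>))"

locale clone_predicate =
  fixes Y :: "('s, 'y, 'm) clone_scheme" and P :: "'s list \<Rightarrow> 's \<Rightarrow> 'y set"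
  assumes pred_subset: "P \<Gamma> A \<subseteq> tms Y \<Gamma> A"
    and pred_var: "i < length \<Gamma> \<Longrightarrow> var Y \<Gamma> ! i \<in> P \<Gamma> (\<Gamma> ! i)"
    and pred_subst:
      "\<lbrakk>t \<in> P \<Delta> B; \<sigma> \<in> substs P \<Gamma> \<Delta>\<rbrakk> \<Longrightarrow> subst Y \<Gamma> \<Delta> B t \<sigma> \<in> P \<Gamma> B"


section \<open>Second-order presentations\<close>

type_synonym 's mctx = "('s list \<times> 's) list"

type_synonym ('s, 'o) signature = "'s mctx \<Rightarrow> 's \<Rightarrow> 'o set"

text \<open>
  Terms up to \<open>\<alpha>\<close>-equivalence are represented by de Bruijn levels: a variable is its position
  in the variable context, counted from the left, and an argument of an operator lives in the
  context extended on the right by the variables bound in it. The sets of operators of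
  different arities need not be disjoint, so an operator occurrence carries its arity.
\<close>

datatype ('s, 'o) tm =
    Var nat
  | MVar nat "('s, 'o) tm list"
  | Op "'s mctx" 's 'o "('s, 'o) tm list"

inductive has_type ::
  "('s, 'o) signature \<Rightarrow> 's mctx \<Rightarrow> 's list \<Rightarrow> ('s, 'o) tm \<Rightarrow> 's \<Rightarrow> bool"
  for Sg :: "('s, 'o) signature" and \<Psi> :: "'s mctx" where
  Var: "i < length \<Gamma> \<Longrightarrow> has_type Sg \<Psi> \<Gamma> (Var i) (\<Gamma> ! i)"
| MVar:
    "\<lbrakk>i < length \<Psi>; \<Psi> ! i = (\<Delta>, B); list_all2 (\<lambda>t A. has_type Sg \<Psi> \<Gamma> t A) ts \<Delta>\<rbrakk>
      \<Longrightarrow> has_type Sg \<Psi> \<Gamma> (MVar i ts) B"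
| Op:
    "\<lbrakk>c \<in> Sg \<Phi> B; list_all2 (\<lambda>t (\<Delta>, A). has_type Sg \<Psi> (\<Gamma> @ \<Delta>) t A) ts \<Phi>\<rbrakk>
      \<Longrightarrow> has_type Sg \<Psi> \<Gamma> (Op \<Phi> B c ts) B"

record ('s, 'o) presentation =
  ops :: "('s, 'o) signature"
  eqs :: "'s mctx \<Rightarrow> 's \<Rightarrow> (('s, 'o) tm \<times> ('s, 'o) tm) set"

locale presentation =
  fixes Pr :: "('s, 'o) presentation"
  assumes eqs_typed:
    "(t, u) \<in> eqs Pr \<Psi> B \<Longrightarrow> has_type (ops Pr) \<Psi> [] t B \<and> has_type (ops Pr) \<Psi> [] u B"


section \<open>Algebras\<close>

text \<open>\<open>args X \<Gamma> [(\<Delta>\<^sub>1,A\<^sub>1),\<dots>,(\<Delta>\<^sub>n,A\<^sub>n)]\<close> is the product of the \<open>X(\<Gamma>,\<Delta>\<^sub>i;A\<^sub>i)\<close>.\<close>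

definition args :: "('s list \<Rightarrow> 's \<Rightarrow> 'x set) \<Rightarrow> 's list \<Rightarrow> 's mctx \<Rightarrow> 'x list set" where
  "args X \<Gamma> \<Psi> = {ts. list_all2 (\<lambda>t (\<Delta>, A). t \<in> X (\<Gamma> @ \<Delta>) A) ts \<Psi>}"

record ('s, 'x, 'o) algebra = "('s, 'x) clone" +
  opr :: "'s mctx \<Rightarrow> 's \<Rightarrow> 'o \<Rightarrow> 's list \<Rightarrow> 'x list \<Rightarrow> 'x"

locale sig_algebra = clone X
  for Sg :: "('s, 'o) signature" and X :: "('s, 'x, 'o) algebra" +
  assumes opr_closed:
      "\<lbrakk>c \<in> Sg \<Psi> B; ts \<in> args (tms X) \<Gamma> \<Psi>\<rbrakk> \<Longrightarrow> opr X \<Psi> B c \<Gamma> ts \<in> tms X \<Gamma> B"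
    and opr_subst:
      "\<lbrakk>c \<in> Sg \<Psi> B; ts \<in> args (tms X) \<Gamma> \<Psi>; \<sigma> \<in> substs (tms X) \<Xi> \<Gamma>\<rbrakk>
        \<Longrightarrow> subst X \<Xi> \<Gamma> B (opr X \<Psi> B c \<Gamma> ts) \<sigma>
          = opr X \<Psi> B c \<Xi>
              (map2 (\<lambda>t (\<Delta>, A). subst X (\<Xi> @ \<Delta>) (\<Gamma> @ \<Delta>) A t (lift X \<Xi> \<Gamma> \<Delta> \<sigma>)) ts \<Psi>)"

locale algebra_hom = clone_hom X Y f
  for Sg :: "('s, 'o) signature"
    and X :: "('s, 'x, 'o) algebra" and Y :: "('s, 'y, 'o) algebra"
    and f :: "'s list \<Rightarrow> 's \<Rightarrow> 'x \<Rightarrow> 'y" +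
  assumes hom_opr:
    "\<lbrakk>c \<in> Sg \<Psi> B; ts \<in> args (tms X) \<Gamma> \<Psi>\<rbrakk>
      \<Longrightarrow> f \<Gamma> B (opr X \<Psi> B c \<Gamma> ts)
        = opr Y \<Psi> B c \<Gamma> (map2 (\<lambda>t (\<Delta>, A). f (\<Gamma> @ \<Delta>) A t) ts \<Psi>)"

text \<open>
  \<open>interp X \<Psi> \<Gamma> \<Xi> t\<close> interprets a term \<open>\<Psi> | \<Xi> \<turnstile> t : B\<close> as a map from \<open>args (tms X) \<Gamma> \<Psi>\<close> to
  \<open>X(\<Gamma>,\<Xi>;B)\<close>. It is only meaningful on well-typed terms.
\<close>

function interp ::
  "('s, 'x, 'o) algebra \<Rightarrow> 's mctx \<Rightarrow> 's list \<Rightarrow> 's list \<Rightarrow> ('s, 'o) tm \<Rightarrow> 'x list \<Rightarrow> 'x" where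
  "interp X \<Psi> \<Gamma> \<Xi> (Var i) \<sigma> = var X (\<Gamma> @ \<Xi>) ! (length \<Gamma> + i)"
| "interp X \<Psi> \<Gamma> \<Xi> (MVar i ts) \<sigma> =
    (let (\<Delta>, B) = \<Psi> ! i in
      subst X (\<Gamma> @ \<Xi>) (\<Gamma> @ \<Delta>) B (\<sigma> ! i)
        (take (length \<Gamma>) (var X (\<Gamma> @ \<Xi>)) @ map (\<lambda>t. interp X \<Psi> \<Gamma> \<Xi> t \<sigma>) ts))"
| "interp X \<Psi> \<Gamma> \<Xi> (Op \<Phi> B c ts) \<sigma> =
    opr X \<Phi> B c (\<Gamma> @ \<Xi>) (map (\<lambda>(t, \<Delta>, A). interp X \<Psi> \<Gamma> (\<Xi> @ \<Delta>) t \<sigma>) (zip ts \<Phi>))"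
  by pat_completeness auto

termination
proof (relation "measure (\<lambda>(_, _, _, _, t, _). size t)", goal_cases)
  case (3 X \<Psi> \<Gamma> \<Xi> \<Phi> B c ts \<sigma> p t q \<Delta> A)
  then have "t \<in> set ts"
    by (auto dest: set_zip_leftD)
  then show ?case
    by (auto dest: size_list_estimation'[where f = size, OF _ order_refl])
qed (auto dest: size_list_estimation'[where f = size, OF _ order_refl])

locale presentation_algebra = sig_algebra "ops Pr" X
  for Pr :: "('s, 'o) presentation" and X :: "('s, 'x, 'o) algebra" +
  assumes eqs_valid:
    "\<lbrakk>(t, u) \<in> eqs Pr \<Psi> A; \<sigma> \<in> args (tms X) \<Gamma> \<Psi>\<rbrakk>
      \<Longrightarrow> interp X \<Psi> \<Gamma> [] t \<sigma> = interp X \<Psi> \<Gamma> [] u \<sigma>"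


section \<open>Free algebras\<close>

text \<open>\<open>h\<close> is an algebra homomorphism \<open>F \<rightarrow> Y\<close> with \<open>h \<circ> \<eta> = f\<close>.\<close>

definition extends_hom ::
  "('s, 'o) signature \<Rightarrow> ('s, 'x) clone \<Rightarrow> ('s, 'z, 'o) algebra \<Rightarrow> ('s list \<Rightarrow> 's \<Rightarrow> 'x \<Rightarrow> 'z) \<Rightarrow>
    ('s, 'y, 'o) algebra \<Rightarrow> ('s list \<Rightarrow> 's \<Rightarrow> 'x \<Rightarrow> 'y) \<Rightarrow> ('s list \<Rightarrow> 's \<Rightarrow> 'z \<Rightarrow> 'y) \<Rightarrow> bool" where
  "extends_hom Sg X F \<eta> Y f h \<longleftrightarrow>
    algebra_hom Sg F Y h \<and> (\<forall>\<Gamma> A. \<forall>t\<in>tms X \<Gamma> A. h \<Gamma> A (\<eta> \<Gamma> A t) = f \<Gamma> A t)"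

text \<open>
  HOL cannot quantify over types inside a formula, so the universal property is stated
  for all algebras whose elements are drawn from a given, arbitrary type \<open>'y\<close>. Homomorphisms
  are total functions, hence unique only on the sets \<open>F(\<Gamma>;A)\<close>.
\<close>

definition free_algebra ::
  "'y itself \<Rightarrow> ('s, 'o) presentation \<Rightarrow> ('s, 'x) clone \<Rightarrow> ('s, 'z, 'o) algebra \<Rightarrow>
    ('s list \<Rightarrow> 's \<Rightarrow> 'x \<Rightarrow> 'z) \<Rightarrow> bool" where
  "free_algebra (_ :: 'y itself) Pr X F \<eta> \<longleftrightarrow>
    presentation_algebra Pr F \<and> clone_hom X F \<eta> \<and>
    (\<forall>(Y :: ('s, 'y, 'o) algebra) f. presentation_algebra Pr Y \<and> clone_hom X Y f \<longrightarrow>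
      (\<exists>h. extends_hom (ops Pr) X F \<eta> Y f h \<and>
        (\<forall>h'. extends_hom (ops Pr) X F \<eta> Y f h' \<longrightarrow>
          (\<forall>\<Gamma> A. \<forall>t\<in>tms F \<Gamma> A. h' \<Gamma> A t = h \<Gamma> A t))))"

end

theory Submission
  imports Defs
begin

text \<open>
  By the closure hypotheses, replacing the terms of \<open>Y\<close> by the predicate \<open>P\<close> gives a subalgebra
  of \<open>Y\<close>, which still satisfies the equations, and \<open>f\<close> corestricts to it. The
  homomorphism into this subalgebra given by the universal property also extends \<open>f\<close> as a
  homomorphism into \<open>Y\<close>, so by uniqueness it is \<open>f\<^sup>\<dagger>\<close>.
\<close>

lemma substs_mono:
  assumes "\<And>\<Gamma> A. P \<Gamma> A \<subseteq> Q \<Gamma> A"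
  shows "substs P \<Gamma> \<Delta> \<subseteq> substs Q \<Gamma> \<Delta>"
  using assms by (auto simp: substs_def elim!: list_all2_mono)

lemma args_mono:
  assumes "\<And>\<Gamma> A. P \<Gamma> A \<subseteq> Q \<Gamma> A"
  shows "args P \<Gamma> \<Psi> \<subseteq> args Q \<Gamma> \<Psi>"
  using assms by (fastforce simp: args_def elim!: list_all2_mono)

text \<open>\<open>lift\<close> is built from \<open>var\<close> and \<open>subst\<close> alone, and
  the update keeps both.\<close>

lemma lift_tms_update [simp]: "lift (X\<lparr>tms := P\<rparr>) = lift X"
  by (simp add: lift_def fun_eq_iff)

text \<open>This carries the equations of \<open>Y\<close> over to the subalgebra: interpretation is
  computed by \<open>var\<close>, \<open>subst\<close> and \<open>opr\<close>, which are
  shared.\<close>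

lemma interp_tms_update: "interp (X\<lparr>tms := P\<rparr>) \<Psi> \<Gamma> \<Xi> t \<sigma> = interp X \<Psi> \<Gamma> \<Xi> t \<sigma>"
proof (induction X \<Psi> \<Gamma> \<Xi> t \<sigma> rule: interp.induct)
  case (2 X \<Psi> \<Gamma> \<Xi> i ts \<sigma>)
  \<comment> \<open>The recursive calls sit under the \<open>let\<close> pattern, so the entry is
    split into a pair to reach the induction hypothesis.\<close>
  obtain \<Delta> B where "\<Psi> ! i = (\<Delta>, B)"
    by fastforce
  with 2 show ?case
    by (simp cong: map_cong)
next
  case (3 X \<Psi> \<Gamma> \<Xi> \<Phi> B c ts \<sigma>)
  have "map (\<lambda>(t, \<Delta>, A). interp (X\<lparr>tms := P\<rparr>) \<Psi> \<Gamma> (\<Xi> @ \<Delta>) t \<sigma>) (zip ts \<Phi>)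
    = map (\<lambda>(t, \<Delta>, A). interp X \<Psi> \<Gamma> (\<Xi> @ \<Delta>) t \<sigma>) (zip ts \<Phi>)"
    using 3 by (intro map_cong) auto
  then show ?case
    by (simp only: interp.simps) simp
qed simp

text \<open>The predicate axioms give closure; the equational laws are those of \<open>Y\<close>,
  restricted to fewer terms and substitutions.\<close>

lemma clone_tms_update:
  assumes "clone Y" and "clone_predicate Y P"
  shows "clone (Y\<lparr>tms := P\<rparr>)"
proof -
  interpret Y: clone Y by fact
  interpret clone_predicate Y P by fact
  have tms: "t \<in> tms Y \<Gamma> A" if "t \<in> P \<Gamma> A" for t \<Gamma> A
    using that pred_subset by blast
  have substs: "\<sigma> \<in> substs (tms Y) \<Gamma> \<Delta>" if "\<sigma> \<in> substs P \<Gamma> \<Delta>" for \<sigma> \<Gamma> \<Delta>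
    using that substs_mono[of P "tms Y"] pred_subset by blast
  show ?thesis
  proof
    show "var (Y\<lparr>tms := P\<rparr>) \<Gamma> \<in> substs (tms (Y\<lparr>tms := P\<rparr>)) \<Gamma> \<Gamma>" for \<Gamma>
      \<comment> \<open>\<open>Y.var_closed\<close> supplies the length of the tuple,
        \<open>pred_var\<close> the membership of each entry.\<close>
      using Y.var_closed[of \<Gamma>] by (auto simp: substs_def list_all2_conv_all_nth pred_var)
  qed (simp_all add: pred_subst Y.var_subst Y.subst_var Y.subst_subst tms substs)
qed

lemma sig_algebra_tms_update:
  assumes "sig_algebra Sg Y" and "clone_predicate Y P"
    and closed: "\<And>c \<Psi> B \<Gamma> ts. \<lbrakk>c \<in> Sg \<Psi> B; ts \<in> args P \<Gamma> \<Psi>\<rbrakk> \<Longrightarrow> opr Y \<Psi> B c \<Gamma> ts \<in> P \<Gamma> B"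
  shows "sig_algebra Sg (Y\<lparr>tms := P\<rparr>)"
proof -
  interpret Y: sig_algebra Sg Y by fact
  interpret clone_predicate Y P by fact
  interpret clone "Y\<lparr>tms := P\<rparr>"
    by (intro clone_tms_update Y.clone_axioms clone_predicate_axioms)
  have substs: "\<sigma> \<in> substs (tms Y) \<Gamma> \<Delta>" if "\<sigma> \<in> substs P \<Gamma> \<Delta>" for \<sigma> \<Gamma> \<Delta>
    using that substs_mono[of P "tms Y"] pred_subset by blast
  have args: "ts \<in> args (tms Y) \<Gamma> \<Psi>" if "ts \<in> args P \<Gamma> \<Psi>" for ts \<Gamma> \<Psi>
    using that args_mono[of P "tms Y"] pred_subset by blast
  show ?thesis
    \<comment> \<open>Compatibility with substitution is inherited from \<open>Y\<close>, once
      \<open>lift\<close> in the subalgebra is rewritten to \<open>lift\<close> in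
      \<open>Y\<close>.\<close>
    by unfold_locales (simp_all add: closed Y.opr_subst substs args)
qed

lemma presentation_algebra_tms_update:
  assumes "presentation_algebra Pr Y" and "clone_predicate Y P"
    and "\<And>c \<Psi> B \<Gamma> ts. \<lbrakk>c \<in> ops Pr \<Psi> B; ts \<in> args P \<Gamma> \<Psi>\<rbrakk> \<Longrightarrow> opr Y \<Psi> B c \<Gamma> ts \<in> P \<Gamma> B"
  shows "presentation_algebra Pr (Y\<lparr>tms := P\<rparr>)"
proof -
  interpret Y: presentation_algebra Pr Y by fact
  interpret clone_predicate Y P by fact
  interpret sig_algebra "ops Pr" "Y\<lparr>tms := P\<rparr>"
    by (intro sig_algebra_tms_update Y.sig_algebra_axioms assms)
  have args: "ts \<in> args (tms Y) \<Gamma> \<Psi>" if "ts \<in> args P \<Gamma> \<Psi>" for ts \<Gamma> \<Psi>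
    using that args_mono[of P "tms Y"] pred_subset by blast
  show ?thesis
    by unfold_locales (simp add: interp_tms_update Y.eqs_valid args)
qed

lemma clone_hom_tms_update:
  assumes "clone_hom X Y f" and "\<And>\<Gamma> A t. t \<in> tms X \<Gamma> A \<Longrightarrow> f \<Gamma> A t \<in> P \<Gamma> A"
  shows "clone_hom X (Y\<lparr>tms := P\<rparr>) f"
  using assms by (simp add: clone_hom_def)

text \<open>This amounts to composing with the inclusion of the subalgebra: the preservation laws
  read the same in both targets, and closedness weakens along
  \<open>P \<Gamma> A \<subseteq> tms Y \<Gamma> A\<close>.\<close>

lemma extends_hom_tms_updateD:
  assumes "extends_hom Sg X F \<eta> (Y\<lparr>tms := P\<rparr>) f h" and "\<And>\<Gamma> A. P \<Gamma> A \<subseteq> tms Y \<Gamma> A"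
  shows "extends_hom Sg X F \<eta> Y f h"
  using assms
  by (simp add: extends_hom_def algebra_hom_def algebra_hom_axioms_def clone_hom_def subset_iff)

theorem theorem26:
  fixes Pr :: "('s, 'o) presentation"
    and Y :: "('s, 'y, 'o) algebra"
    and X :: "('s, 'x) clone"
    and F :: "('s, 'z, 'o) algebra"
    and f :: "'s list \<Rightarrow> 's \<Rightarrow> 'x \<Rightarrow> 'y"
    and \<eta> :: "'s list \<Rightarrow> 's \<Rightarrow> 'x \<Rightarrow> 'z"
    and f_dagger :: "'s list \<Rightarrow> 's \<Rightarrow> 'z \<Rightarrow> 'y"
    and P :: "'s list \<Rightarrow> 's \<Rightarrow> 'y set"
  assumes "presentation Pr"
    and "presentation_algebra Pr Y"
    and "clone X"
    and "clone_hom X Y f"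
    and "clone_predicate Y P"
    and "\<And>c \<Psi> B \<Gamma> ts. \<lbrakk>c \<in> ops Pr \<Psi> B; ts \<in> args P \<Gamma> \<Psi>\<rbrakk> \<Longrightarrow> opr Y \<Psi> B c \<Gamma> ts \<in> P \<Gamma> B"
    and "\<And>\<Gamma> A t. t \<in> tms X \<Gamma> A \<Longrightarrow> f \<Gamma> A t \<in> P \<Gamma> A"
    and "free_algebra TYPE('y) Pr X F \<eta>"
    and "extends_hom (ops Pr) X F \<eta> Y f f_dagger"
  shows "\<forall>\<Gamma> A. \<forall>t\<in>tms F \<Gamma> A. f_dagger \<Gamma> A t \<in> P \<Gamma> A"
proof -
  interpret clone_predicate Y P by fact
  let ?Y = "Y\<lparr>tms := P\<rparr>"
  have "presentation_algebra Pr ?Y"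
    using assms by (intro presentation_algebra_tms_update)
  moreover have "clone_hom X ?Y f"
    using assms by (intro clone_hom_tms_update)
  \<comment> \<open>The universal property is available at the type \<open>'y\<close>; the
    subalgebra qualifies because its elements are still drawn from \<open>'y\<close>.\<close>
  ultimately obtain h where h: "extends_hom (ops Pr) X F \<eta> ?Y f h"
    using assms(8) unfolding free_algebra_def by blast
  then have "extends_hom (ops Pr) X F \<eta> Y f h"
    using pred_subset by (rule extends_hom_tms_updateD)
  \<comment> \<open>Freeness at \<open>Y\<close> itself yields one extension with which both
    \<open>f_dagger\<close> and \<open>h\<close> agree on the terms of \<open>F\<close>.\<close>
  with assms(2,4,8,9) have "f_dagger \<Gamma> A t = h \<Gamma> A t" if "t \<in> tms F \<Gamma> A" for \<Gamma> A t
    using that unfolding free_algebra_def by metis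
  \<comment> \<open>This is closedness of \<open>h\<close> as a homomorphism into \<open>?Y\<close>,
    whose sets of terms are given by \<open>P\<close>.\<close>
  moreover have "h \<Gamma> A t \<in> P \<Gamma> A" if "t \<in> tms F \<Gamma> A" for \<Gamma> A t
    using h that by (simp add: extends_hom_def algebra_hom_def clone_hom_def)
  ultimately show ?thesis
    by simp
qed

end
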